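(* Let $f\in\mathcal{C}(\Omega)$, let the quadrature rule have exactness degree $2n$, and let all penalty parameters in Lasso hyperinterpolation be $\mu_\ell=1$, $\ell=1,\dots,d_n$. For any given $\lambda\in[0,\|\mathbf{A}^{\mathrm{T}}\mathbf{W}\mathbf{f}\|_\infty)$, $$\|\mathcal{L}_n^{\lambda}f\|_2\le\|\mathcal{H}_n^{\lambda}f\|_2\le\|\mathcal{L}_nf\|_2,$$ where equality holds when $\lambda=0$. Moreover, $$\|\mathcal{L}_n^{\lambda}\|_{\mathrm{op}}\le\|\mathcal{H}_n^{\lambda}\|_{\mathrm{op}}\le\|\mathcal{L}_n\|_{\mathrm{op}}.$$
   Context: $\Omega\subset\mathbb{R}^s$ is a compact smooth Riemannian manifold with smooth or empty boundary, equipped with a measure $\mathrm{d}\omega$ with $\int_\Omega \mathrm{d}\omega=V<\infty$. $\mathcal{C}(\Omega)$ is the space of continuous real functions on $\Omega$, $\langle f,g\rangle=\int_\Omega fg\,\mathrm{d}\omega$, $\|g\|_2=\langle g,g\rangle^{1/2}$, $\|g\|_\infty=\sup_{\mathbf{x}\in\Omega}|g(\mathbf{x})|$; for a vector, $\|\cdot\|_\infty$ is the maximum absolute entry. For any (possibly nonlinear) operator $\mathcal{U}_n:\mathcal{C}(\Omega)\to L_2(\Omega)$, $\|\mathcal{U}_n\|_{\mathrm{op}}=\sup_{g\in\mathcal{C}(\Omega),\,g\ne0}\|\mathcal{U}_ng\|_2/\|g\|_\infty$. $\mathbb{P}_n(\Omega)$ is the space of polynomials of total degree at most $n$ restricted to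 $\Omega$, $d_n=\dim\mathbb{P}_n(\Omega)$, and $\{\Phi_\ell\}_{\ell=1}^{d_n}$ is a fixed orthonormal basis of $\mathbb{P}_n(\Omega)$ with respect to $\langle\cdot,\cdot\rangle$. Quadrature rule: nodes $\mathbf{x}_1,\dots,\mathbf{x}_N\in\Omega$ and weights $w_1,\dots,w_N>0$ such that $\int_\Omega p\,\mathrm{d}\omega=\sum_{j=1}^N w_jp(\mathbf{x}_j)$ for all $p\in\mathbb{P}_{2n}(\Omega)$ (exactness degree $2n$). The discrete (semi) inner product is $\langle f,g\rangle_N=\sum_{j=1}^N w_jf(\mathbf{x}_j)g(\mathbf{x}_j)$. Further, $\mathbf{W}=\mathrm{diag}(w_1,\dots,w_N)$, $\mathbf{A}\in\mathbb{R}^{N\times d_n}$ with $[\mathbf{A}]_{j\ell}=\Phi_\ell(\mathbf{x}_j)$, and $\mathbf{f}=[f(\mathbf{x}_1),\dots,f(\mathbf{x}_N)]^{\mathrm{T}}$. Hyperinterpolation: $\mathcal{L}_nf=\sum_{\ell=1}^{d_n}\langle f,\Phi_\ell\rangle_N\Phi_\ell$. Lasso hyperinterpolation: $\mathcal{L}_n^\lambda f=\sum_{\ell=1}^{d_n}\eta_S(\langle f,\Phi_\ell\rangle_N,\lambda\mu_\ell)\Phi_\ell$, with soft thresholding operator $\eta_S(a,k)=\max(0,a-k)+\min(0,a+k)$ and positive penalty parameters $\mu_\ell$. Hard thresholding hyperinterpolation: $\mathcal{H}_n^\lambda f=\sum_{\ell=1}^{d_n}\eta_H(\langle f,\Phi_\ell\rangle_N,\lambda)\Phi_\ell$,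 with hard thresholding operator $\eta_H(a,k)=a$ if $|a|>k$ and $\eta_H(a,k)=0$ if $|a|\le k$. For $\lambda=0$ the same formulas apply, and both operators reduce to $\mathcal{L}_n$. *)

theory Defs
  imports
    "HOL-Analysis.Analysis"
    "HOL-Library.Function_Algebras"
    "Jordan_Normal_Form.Matrix"
begin

text \<open>
  On an open set \<open>U\<close> of a
  finite-dimensional space, \<open>f\<close> is of class $C^{k+1}$ iff it is differentiable and all its
  directional derivatives are of class $C^k$.
\<close>

primrec C_k_on :: "nat \<Rightarrow> 'a::euclidean_space set \<Rightarrow> ('a \<Rightarrow> 'b::real_normed_vector) \<Rightarrow> bool" where
  "C_k_on 0 U f \<longleftrightarrow> continuous_on U f"
| "C_k_on (Suc k) U f \<longleftrightarrow> (\<forall>x\<in>U. f differentiable (at x)) \<and>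
     (\<forall>v. C_k_on k U (\<lambda>x. frechet_derivative f (at x) v))"

definition smooth_on :: "'a::euclidean_space set \<Rightarrow> ('a \<Rightarrow> 'b::real_normed_vector) \<Rightarrow> bool" where
  "smooth_on U f \<longleftrightarrow> open U \<and> (\<forall>k. C_k_on k U f)"

definition diffeomorphism_on :: "'a::euclidean_space set \<Rightarrow> ('a \<Rightarrow> 'a) \<Rightarrow> bool" where
  "diffeomorphism_on U \<phi> \<longleftrightarrow> smooth_on U \<phi> \<and>
     (\<exists>\<psi>. smooth_on (\<phi> ` U) \<psi> \<and> (\<forall>x\<in>U. \<psi> (\<phi> x) = x))"

text \<open>
  \<open>H\<close> is the \<open>m\<close>-dimensional linear subspace \<open>S\<close>, or a closed half-space of \<open>S\<close>.
\<close>

definition local_model :: "nat \<Rightarrow> 'a::euclidean_space set \<Rightarrow> 'a set \<Rightarrow> bool" where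
  "local_model m S H \<longleftrightarrow> subspace S \<and> dim S = m \<and>
     (H = S \<or> (\<exists>e\<in>S. e \<noteq> 0 \<and> H = {y \<in> S. 0 \<le> e \<bullet> y}))"

text \<open>
  Slice charts: diffeomorphisms of open subsets of the ambient space that flatten \<open>\<Omega>\<close> onto an
  open part of the local model.
\<close>

definition slice_chart ::
  "nat \<Rightarrow> 'a::euclidean_space set \<Rightarrow> 'a set \<Rightarrow> ('a \<Rightarrow> 'a) \<Rightarrow> 'a set \<Rightarrow> 'a set \<Rightarrow> bool" where
  "slice_chart m \<Omega> U \<phi> S H \<longleftrightarrow>
     local_model m S H \<and> diffeomorphism_on U \<phi> \<and> \<phi> ` (U \<inter> \<Omega>) = \<phi> ` U \<inter> H"

definition smooth_submanifold :: "nat \<Rightarrow> 'a::euclidean_space set \<Rightarrow> bool" where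
  "smooth_submanifold m \<Omega> \<longleftrightarrow> (\<forall>p\<in>\<Omega>. \<exists>U \<phi> S H. p \<in> U \<and> slice_chart m \<Omega> U \<phi> S H)"

definition tangent_space :: "nat \<Rightarrow> 'a::euclidean_space set \<Rightarrow> 'a \<Rightarrow> 'a set" where
  "tangent_space m \<Omega> p =
     {v. \<exists>U \<phi> S H. p \<in> U \<and> slice_chart m \<Omega> U \<phi> S H \<and> frechet_derivative \<phi> (at p) v \<in> S}"

text \<open>
  A metric on \<open>\<Omega>\<close> is smooth iff it extends, locally around each point of \<open>\<Omega>\<close>, to a smooth field
  \<open>G\<close> of bilinear forms on the ambient space. Only the values of \<open>g\<close> on tangent vectors matter.
\<close>

definition riemannian_metric ::
  "nat \<Rightarrow> 'a::euclidean_space set \<Rightarrow> ('a \<Rightarrow> 'a \<Rightarrow> 'a \<Rightarrow> real) \<Rightarrow> bool" where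
  "riemannian_metric m \<Omega> g \<longleftrightarrow>
     (\<forall>p\<in>\<Omega>.
        (\<forall>v\<in>tangent_space m \<Omega> p. \<forall>w\<in>tangent_space m \<Omega> p. g p v w = g p w v) \<and>
        (\<forall>v\<in>tangent_space m \<Omega> p. v \<noteq> 0 \<longrightarrow> 0 < g p v v) \<and>
        (\<exists>U G. p \<in> U \<and> (\<forall>x\<in>U. bilinear (G x)) \<and> (\<forall>v w. smooth_on U (\<lambda>x. G x v w)) \<and>
           (\<forall>x\<in>U \<inter> \<Omega>. \<forall>v\<in>tangent_space m \<Omega> x. \<forall>w\<in>tangent_space m \<Omega> x. g x v w = G x v w)))"

text \<open>
  A real function on \<open>\<Omega>\<close> is represented by its extension by zero to the whole type, so that
  equality, \<open>0\<close>, linear span and dimension are those of functions on \<open>\<Omega>\<close>.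
\<close>

definition extend_zero :: "'a set \<Rightarrow> ('a \<Rightarrow> real) \<Rightarrow> 'a \<Rightarrow> real" where
  "extend_zero \<Omega> g = (\<lambda>x. if x \<in> \<Omega> then g x else 0)"

definition fun_scale :: "real \<Rightarrow> ('a \<Rightarrow> real) \<Rightarrow> 'a \<Rightarrow> real" where
  "fun_scale c g = (\<lambda>x. c * g x)"

interpretation fun_vs: vector_space "fun_scale :: real \<Rightarrow> ('a \<Rightarrow> real) \<Rightarrow> 'a \<Rightarrow> real"
  by unfold_locales (auto simp: fun_scale_def fun_eq_iff algebra_simps)

definition C_space :: "'a::topological_space set \<Rightarrow> ('a \<Rightarrow> real) set" where
  "C_space \<Omega> = {g. continuous_on \<Omega> g \<and> (\<forall>x. x \<notin> \<Omega> \<longrightarrow> g x = 0)}"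

definition sup_norm :: "'a set \<Rightarrow> ('a \<Rightarrow> real) \<Rightarrow> real" where
  "sup_norm \<Omega> g = (SUP x\<in>\<Omega>. \<bar>g x\<bar>)"

definition L2_inner :: "'a measure \<Rightarrow> ('a \<Rightarrow> real) \<Rightarrow> ('a \<Rightarrow> real) \<Rightarrow> real" where
  "L2_inner M f g = (LINT x|M. f x * g x)"

definition L2_norm :: "'a measure \<Rightarrow> ('a \<Rightarrow> real) \<Rightarrow> real" where
  "L2_norm M g = sqrt (L2_inner M g g)"

text \<open>
  The supremum is taken in the extended reals, so that it does not presuppose boundedness.
\<close>

definition op_norm ::
  "'a::topological_space measure \<Rightarrow> 'a set \<Rightarrow> (('a \<Rightarrow> real) \<Rightarrow> 'a \<Rightarrow> real) \<Rightarrow> ereal" where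
  "op_norm M \<Omega> T = (SUP g \<in> {g \<in> C_space \<Omega>. g \<noteq> 0}. ereal (L2_norm M (T g) / sup_norm \<Omega> g))"

definition monomial :: "('s::finite \<Rightarrow> nat) \<Rightarrow> real^'s \<Rightarrow> real" where
  "monomial \<alpha> x = (\<Prod>i\<in>UNIV. (x $ i) ^ \<alpha> i)"

definition poly_space :: "(real^'s::finite) set \<Rightarrow> nat \<Rightarrow> (real^'s \<Rightarrow> real) set" where
  "poly_space \<Omega> n = fun_vs.span {extend_zero \<Omega> (monomial \<alpha>) |\<alpha>. (\<Sum>i\<in>UNIV. \<alpha> i) \<le> n}"

definition poly_dim :: "(real^'s::finite) set \<Rightarrow> nat \<Rightarrow> nat" where
  "poly_dim \<Omega> n = fun_vs.dim (poly_space \<Omega> n)"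

text \<open>
  The basis functions are \<open>\<Phi> 0, \<dots>, \<Phi> (d - 1)\<close> and the nodes are \<open>x 0, \<dots>, x (N - 1)\<close>.
\<close>

definition orthonormal_poly_basis ::
  "(real^'s::finite) measure \<Rightarrow> (real^'s) set \<Rightarrow> nat \<Rightarrow> (nat \<Rightarrow> real^'s \<Rightarrow> real) \<Rightarrow> bool" where
  "orthonormal_poly_basis M \<Omega> n \<Phi> \<longleftrightarrow>
     fun_vs.span (\<Phi> ` {..<poly_dim \<Omega> n}) = poly_space \<Omega> n \<and>
     (\<forall>k<poly_dim \<Omega> n. \<forall>l<poly_dim \<Omega> n. L2_inner M (\<Phi> k) (\<Phi> l) = (if k = l then 1 else 0))"

definition exact_quadrature ::
  "(real^'s::finite) measure \<Rightarrow> (real^'s) set \<Rightarrow> nat \<Rightarrow> nat \<Rightarrow> (nat \<Rightarrow> real^'s) \<Rightarrow> (nat \<Rightarrow> real) \<Rightarrow> bool"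
where
  "exact_quadrature M \<Omega> deg N x w \<longleftrightarrow>
     (\<forall>j<N. x j \<in> \<Omega> \<and> 0 < w j) \<and>
     (\<forall>p\<in>poly_space \<Omega> deg. (LINT y|M. p y) = (\<Sum>j<N. w j * p (x j)))"

definition discrete_inner ::
  "nat \<Rightarrow> (nat \<Rightarrow> 'a) \<Rightarrow> (nat \<Rightarrow> real) \<Rightarrow> ('a \<Rightarrow> real) \<Rightarrow> ('a \<Rightarrow> real) \<Rightarrow> real" where
  "discrete_inner N x w f g = (\<Sum>j<N. w j * f (x j) * g (x j))"

definition soft_threshold :: "real \<Rightarrow> real \<Rightarrow> real" where
  "soft_threshold a k = max 0 (a - k) + min 0 (a + k)"

definition hard_threshold :: "real \<Rightarrow> real \<Rightarrow> real" where
  "hard_threshold a k = (if \<bar>a\<bar> > k then a else 0)"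

definition hyperinterp ::
  "nat \<Rightarrow> (nat \<Rightarrow> 'a) \<Rightarrow> (nat \<Rightarrow> real) \<Rightarrow> nat \<Rightarrow> (nat \<Rightarrow> 'a \<Rightarrow> real) \<Rightarrow> ('a \<Rightarrow> real) \<Rightarrow> 'a \<Rightarrow> real" where
  "hyperinterp N x w d \<Phi> f = (\<lambda>y. \<Sum>l<d. discrete_inner N x w f (\<Phi> l) * \<Phi> l y)"

definition lasso_hyperinterp ::
  "nat \<Rightarrow> (nat \<Rightarrow> 'a) \<Rightarrow> (nat \<Rightarrow> real) \<Rightarrow> nat \<Rightarrow> (nat \<Rightarrow> 'a \<Rightarrow> real) \<Rightarrow> (nat \<Rightarrow> real) \<Rightarrow> real
    \<Rightarrow> ('a \<Rightarrow> real) \<Rightarrow> 'a \<Rightarrow> real" where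
  "lasso_hyperinterp N x w d \<Phi> \<mu> lam f =
     (\<lambda>y. \<Sum>l<d. soft_threshold (discrete_inner N x w f (\<Phi> l)) (lam * \<mu> l) * \<Phi> l y)"

definition hard_hyperinterp ::
  "nat \<Rightarrow> (nat \<Rightarrow> 'a) \<Rightarrow> (nat \<Rightarrow> real) \<Rightarrow> nat \<Rightarrow> (nat \<Rightarrow> 'a \<Rightarrow> real) \<Rightarrow> real
    \<Rightarrow> ('a \<Rightarrow> real) \<Rightarrow> 'a \<Rightarrow> real" where
  "hard_hyperinterp N x w d \<Phi> lam f =
     (\<lambda>y. \<Sum>l<d. hard_threshold (discrete_inner N x w f (\<Phi> l)) lam * \<Phi> l y)"

definition weight_mat :: "nat \<Rightarrow> (nat \<Rightarrow> real) \<Rightarrow> real mat" where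
  "weight_mat N w = mat_diag N w"

definition sampling_mat :: "nat \<Rightarrow> (nat \<Rightarrow> 'a) \<Rightarrow> nat \<Rightarrow> (nat \<Rightarrow> 'a \<Rightarrow> real) \<Rightarrow> real mat" where
  "sampling_mat N x d \<Phi> = Matrix.mat N d (\<lambda>(j, l). \<Phi> l (x j))"

definition sample_vec :: "nat \<Rightarrow> (nat \<Rightarrow> 'a) \<Rightarrow> ('a \<Rightarrow> real) \<Rightarrow> real Matrix.vec" where
  "sample_vec N x f = Matrix.vec N (\<lambda>j. f (x j))"

text \<open>The element \<open>0\<close> only matters for the empty vector, whose norm is \<open>0\<close>.\<close>

definition max_norm_vec :: "real Matrix.vec \<Rightarrow> real" where
  "max_norm_vec v = Max (insert 0 (abs ` vec_set v))"

end

theory Submission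
  imports Defs
begin

text \<open>
  Products of polynomials are integrable on the compact set, so Parseval's identity
  turns the L2 norms into Euclidean norms of coefficient vectors. The thresholded coefficients
  satisfy \<open>\<bar>soft\<bar> \<le> \<bar>hard\<bar> \<le> \<bar>id\<bar>\<close> entrywise for every input function, and the operator
  norms inherit the pointwise comparison.
\<close>

lemma subspace_C_space: "fun_vs.subspace (C_space \<Omega>)"
  by (rule fun_vs.subspaceI)
    (auto simp: C_space_def fun_scale_def intro!: continuous_intros
      simp: plus_fun_def zero_fun_def)

text \<open>Since \<open>C_space\<close> is a subspace, only the spanning monomials have to be
  checked. Extension by zero leaves a monomial unchanged on \<Omega>, so continuity on \<Omega>
  survives it.\<close>

lemma poly_space_subset_C_space:
  fixes \<Omega> :: "(real^'s::finite) set"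
  shows "poly_space \<Omega> n \<subseteq> C_space \<Omega>"
proof -
  have "extend_zero \<Omega> (monomial \<alpha>) \<in> C_space \<Omega>" for \<alpha> :: "'s \<Rightarrow> nat"
  proof -
    have "continuous_on \<Omega> (monomial \<alpha>)"
      unfolding monomial_def by (intro continuous_intros)
    then have "continuous_on \<Omega> (extend_zero \<Omega> (monomial \<alpha>))"
      by (rule continuous_on_eq) (simp add: extend_zero_def)
    then show ?thesis
      by (simp add: C_space_def extend_zero_def)
  qed
  then show ?thesis
    unfolding poly_space_def by (intro fun_vs.span_minimal subspace_C_space) auto
qed

lemma continuous_on_compact_abs_bdd_above:
  fixes g :: "'a::topological_space \<Rightarrow> real"
  assumes "compact \<Omega>" "continuous_on \<Omega> g"
  shows "bdd_above ((\<lambda>x. \<bar>g x\<bar>) ` \<Omega>)"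
  using assms by (intro compact_imp_bounded bounded_imp_bdd_above compact_continuous_image
      continuous_intros)

text \<open>A real supremum is informative only over a nonempty set that is bounded above:
  \<open>g \<noteq> 0\<close> supplies a point of \<Omega>, compactness supplies the bound.\<close>

lemma sup_norm_nonneg:
  assumes "compact \<Omega>" "g \<in> C_space \<Omega>" "g \<noteq> 0"
  shows "0 \<le> sup_norm \<Omega> g"
proof -
  obtain y where "g y \<noteq> 0"
    using assms(3) by (auto simp: fun_eq_iff)
  then have y: "y \<in> \<Omega>"
    using assms(2) by (auto simp: C_space_def)
  have "bdd_above ((\<lambda>x. \<bar>g x\<bar>) ` \<Omega>)"
    using assms by (intro continuous_on_compact_abs_bdd_above) (auto simp: C_space_def)
  then have "\<bar>g y\<bar> \<le> sup_norm \<Omega> g"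
    unfolding sup_norm_def by (intro cSUP_upper y)
  then show ?thesis by linarith
qed

lemma integrable_continuous_on_compact_space:
  fixes g :: "'a::topological_space \<Rightarrow> real"
  assumes "finite_measure M" "compact (space M)"
    and "sets (restrict_space borel (space M)) \<subseteq> sets M"
    and "continuous_on (space M) g"
  shows "integrable M g"
proof -
  interpret finite_measure M by fact
  have "g \<in> borel_measurable (restrict_space borel (space M))"
    using assms(4) by (rule borel_measurable_continuous_on_restrict)
  then have meas: "g \<in> borel_measurable M"
    \<comment> \<open>Preimages are relatively Borel in \<open>space M\<close>, and
      \<open>sets M\<close> may be larger, for instance a completion.\<close>
    using assms(3) by (auto simp: measurable_def space_restrict_space)
  obtain B where "\<And>y. y \<in> space M \<Longrightarrow> \<bar>g y\<bar> \<le> B"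
    using continuous_on_compact_abs_bdd_above[OF assms(2,4)]
    by (auto simp: bdd_above_def)
  then show ?thesis
    by (intro integrable_const_bound[of _ B] meas) auto
qed

text \<open>Both quotients at a given \<open>g\<close> share the nonnegative denominator
  \<open>sup_norm \<Omega> g\<close>, so comparing numerators is enough.\<close>

lemma op_norm_mono:
  assumes "compact \<Omega>"
    and "\<And>g. g \<in> C_space \<Omega> \<Longrightarrow> L2_norm M (S g) \<le> L2_norm M (T g)"
  shows "op_norm M \<Omega> S \<le> op_norm M \<Omega> T"
  unfolding op_norm_def
  using assms by (intro SUP_mono) (auto intro!: divide_right_mono sup_norm_nonneg)

text \<open>Parseval's identity for a finite orthonormal family. Integrability is assumed separately
  because a Bochner integral equal to 0 does not imply it, and the integral must pass through the
  double sum.\<close>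

lemma L2_norm_orthonormal_sum:
  fixes d :: nat
  assumes int: "\<And>k l. k < d \<Longrightarrow> l < d \<Longrightarrow> integrable M (\<lambda>y. \<Phi> k y * \<Phi> l y)"
    and orth: "\<And>k l. k < d \<Longrightarrow> l < d \<Longrightarrow> L2_inner M (\<Phi> k) (\<Phi> l) = (if k = l then 1 else 0)"
  shows "L2_norm M (\<lambda>y. \<Sum>l<d. c l * \<Phi> l y) = sqrt (\<Sum>l<d. (c l)\<^sup>2)"
proof -
  have "L2_inner M (\<lambda>y. \<Sum>l<d. c l * \<Phi> l y) (\<lambda>y. \<Sum>l<d. c l * \<Phi> l y)
      = (LINT y|M. (\<Sum>k<d. \<Sum>l<d. (c k * c l) * (\<Phi> k y * \<Phi> l y)))"
    unfolding L2_inner_def by (simp add: sum_product mult_ac)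
  also have "\<dots> = (\<Sum>k<d. \<Sum>l<d. LINT y|M. (c k * c l) * (\<Phi> k y * \<Phi> l y))"
    using int by (subst Bochner_Integration.integral_sum
        , force intro!: Bochner_Integration.integrable_sum
        , intro sum.cong refl Bochner_Integration.integral_sum, force)
  also have "\<dots> = (\<Sum>k<d. \<Sum>l<d. (c k * c l) * L2_inner M (\<Phi> k) (\<Phi> l))"
    by (simp add: L2_inner_def)
  also have "\<dots> = (\<Sum>k<d. \<Sum>l<d. if k = l then (c k)\<^sup>2 else 0)"
    by (intro sum.cong refl) (auto simp: orth power2_eq_square)
  also have "\<dots> = (\<Sum>k<d. (c k)\<^sup>2)"
    by simp
  finally show ?thesis
    by (simp add: L2_norm_def)
qed

text \<open>Both maps send \<open>\<bar>a\<bar> \<le> k\<close> to 0; beyond that, the hard one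
  keeps \<open>a\<close> while the soft one moves it by \<open>k\<close> towards 0 without crossing.
  A negative \<open>k\<close> would push it away from 0.\<close>

lemma abs_soft_threshold_le_hard:
  "0 \<le> k \<Longrightarrow> \<bar>soft_threshold a k\<bar> \<le> \<bar>hard_threshold a k\<bar>"
  by (auto simp: soft_threshold_def hard_threshold_def max_def min_def)

lemma abs_hard_threshold_le: "\<bar>hard_threshold a k\<bar> \<le> \<bar>a\<bar>"
  by (simp add: hard_threshold_def)

lemma soft_threshold_0 [simp]: "soft_threshold a 0 = a"
  by (simp add: soft_threshold_def)

lemma hard_threshold_0 [simp]: "hard_threshold a 0 = a"
  by (simp add: hard_threshold_def)

theorem theorem4p1:
  fixes \<Omega> :: "(real^'s::finite) set"
    and m :: nat
    and g :: "real^'s \<Rightarrow> real^'s \<Rightarrow> real^'s \<Rightarrow> real"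
    and M :: "(real^'s) measure"
    and n d N :: nat
    and \<Phi> :: "nat \<Rightarrow> real^'s \<Rightarrow> real"
    and x :: "nat \<Rightarrow> real^'s"
    and w \<mu> :: "nat \<Rightarrow> real"
    and f :: "real^'s \<Rightarrow> real"
    and lam :: real
  assumes "compact \<Omega>"
    and "smooth_submanifold m \<Omega>"
    and "riemannian_metric m \<Omega> g"
    and "finite_measure M"
    and "space M = \<Omega>"
    and "sets (restrict_space borel \<Omega>) \<subseteq> sets M"
    and "d = poly_dim \<Omega> n"
    and "orthonormal_poly_basis M \<Omega> n \<Phi>"
    and "exact_quadrature M \<Omega> (2 * n) N x w"
    and "f \<in> C_space \<Omega>"
    and "\<forall>l<d. \<mu> l = 1"
    and "0 \<le> lam"
    and "lam < max_norm_vec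
           ((transpose_mat (sampling_mat N x d \<Phi>) * weight_mat N w) *\<^sub>v sample_vec N x f)"
  shows "L2_norm M (lasso_hyperinterp N x w d \<Phi> \<mu> lam f)
           \<le> L2_norm M (hard_hyperinterp N x w d \<Phi> lam f)
       \<and> L2_norm M (hard_hyperinterp N x w d \<Phi> lam f)
           \<le> L2_norm M (hyperinterp N x w d \<Phi> f)
       \<and> (lam = 0 \<longrightarrow>
            L2_norm M (lasso_hyperinterp N x w d \<Phi> \<mu> lam f)
              = L2_norm M (hard_hyperinterp N x w d \<Phi> lam f)
          \<and> L2_norm M (hard_hyperinterp N x w d \<Phi> lam f)
              = L2_norm M (hyperinterp N x w d \<Phi> f))
       \<and> op_norm M \<Omega> (lasso_hyperinterp N x w d \<Phi> \<mu> lam)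
           \<le> op_norm M \<Omega> (hard_hyperinterp N x w d \<Phi> lam)
       \<and> op_norm M \<Omega> (hard_hyperinterp N x w d \<Phi> lam)
           \<le> op_norm M \<Omega> (hyperinterp N x w d \<Phi>)"
proof -
  have coeff_mono: "L2_norm M (\<lambda>y. \<Sum>l<d. a l * \<Phi> l y) \<le> L2_norm M (\<lambda>y. \<Sum>l<d. b l * \<Phi> l y)"
    if "\<And>l. l < d \<Longrightarrow> \<bar>a l\<bar> \<le> \<bar>b l\<bar>" for a b
  proof -
    have cont: "continuous_on \<Omega> (\<Phi> l)" if "l < d" for l
    proof -
      have "\<Phi> l \<in> fun_vs.span (\<Phi> ` {..<d})"
        using that by (intro fun_vs.span_base) auto
      then have "\<Phi> l \<in> poly_space \<Omega> n"
        using assms(7,8) by (simp add: orthonormal_poly_basis_def)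
      then show ?thesis
        using poly_space_subset_C_space by (auto simp: C_space_def)
    qed
    \<comment> \<open>A product of two basis functions is continuous on the compact space, hence
      bounded and integrable.\<close>
    have int: "integrable M (\<lambda>y. \<Phi> k y * \<Phi> l y)" if "k < d" "l < d" for k l
      using assms(1,4-6) cont that
      by (intro integrable_continuous_on_compact_space) (auto intro!: continuous_on_mult)
    have orth: "L2_inner M (\<Phi> k) (\<Phi> l) = (if k = l then 1 else 0)" if "k < d" "l < d" for k l
      using assms(7,8) that by (simp add: orthonormal_poly_basis_def)
    have "(\<Sum>l<d. (a l)\<^sup>2) \<le> (\<Sum>l<d. (b l)\<^sup>2)"
      using that by (intro sum_mono) (simp add: abs_le_square_iff)
    then show ?thesis
      by (simp add: L2_norm_orthonormal_sum[OF int orth])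
  qed
  \<comment> \<open>Stated for arbitrary \<open>h\<close>, so that it serves both \<open>f\<close>
    and the operator norms. As \<open>\<mu> l = 1\<close>, both thresholds act at level
    \<open>lam\<close>.\<close>
  have lasso_le_hard: "L2_norm M (lasso_hyperinterp N x w d \<Phi> \<mu> lam h)
      \<le> L2_norm M (hard_hyperinterp N x w d \<Phi> lam h)" for h
    unfolding lasso_hyperinterp_def hard_hyperinterp_def
    using assms(11,12) by (intro coeff_mono) (simp add: abs_soft_threshold_le_hard)
  have hard_le: "L2_norm M (hard_hyperinterp N x w d \<Phi> lam h)
      \<le> L2_norm M (hyperinterp N x w d \<Phi> h)" for h
    unfolding hard_hyperinterp_def hyperinterp_def
    by (intro coeff_mono abs_hard_threshold_le)
  show ?thesis
    using assms(1)
    \<comment> \<open>For \<open>lam = 0\<close> both thresholds are the identity, so the three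
      operators unfold to the same sum.\<close>
    by (intro conjI impI lasso_le_hard hard_le op_norm_mono)
      (simp_all add: lasso_hyperinterp_def hard_hyperinterp_def hyperinterp_def)
qed

end
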